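(* Let $f:\mathbb{N}\to\mathbb{C}$ be an arithmetic function (where $\mathbb{N}=\{1,2,3,\dots\}$) for which there is a finite limit of the average value $$\lim_{x\to\infty}\frac{1}{x}\sum_{n\le x} f(n)=c,\qquad c\neq 0.$$ Then $$\sum_{n\le x} n f(n)\sim \frac{c}{2}x^2,\qquad x\to\infty.$$
   Context: An arithmetic function is a function defined on the positive integers with complex values. Sums $\sum_{n\le x}$ run over positive integers $n\le x$. The notation $A(x)\sim B(x)$ as $x\to\infty$ means $A(x)/B(x)\to 1$. *)

theory Defs
  imports "HOL-Analysis.Analysis" "HOL-Library.Landau_Symbols"
begin

(* An arithmetic function is a total function on nat whose value at 0 is never used:
   the summatory function ranges over the positive integers up to the real number x. *)
definition summatory :: "(nat \<Rightarrow> complex) \<Rightarrow> real \<Rightarrow> complex" where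
  "summatory f x = (\<Sum>n | 1 \<le> n \<and> real n \<le> x. f n)"

end

theory Submission
  imports Defs "HOL-Real_Asymp.Real_Asymp"
begin

text \<open>
  Abel summation gives \<open>\<Sum>\<^sub>n\<^sub>\<le>\<^sub>N n f(n) = N S(N) - \<Sum>\<^sub>k\<^sub><\<^sub>N S(k)\<close>, where \<open>S\<close> is the summatory function of \<open>f\<close>.
  As \<open>S(k) = c k + o(k)\<close>, the right-hand side is \<open>c N\<^sup>2 - c N\<^sup>2 / 2 + o(N\<^sup>2)\<close>.
\<close>

lemma summatory_altdef: "summatory f x = (\<Sum>n=1..nat \<lfloor>x\<rfloor>. f n)"
proof -
  have "{n. 1 \<le> n \<and> real n \<le> x} = {1..nat \<lfloor>x\<rfloor>}"
    by (intro set_eqI, simp, linarith)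
  thus ?thesis
    by (simp add: summatory_def)
qed

text \<open>Abel summation. With \<open>S\<close> the partial sums of \<open>f\<close>, passing from
  \<open>n\<close> to \<open>n + 1\<close> adds (n+1) S(n+1) - n S(n) - S(n) = (n+1) f(n+1) on the
  right.\<close>

lemma sum_of_nat_mult_eq_diff_sum_partial_sums:
  fixes f :: "nat \<Rightarrow> 'a :: comm_ring_1"
  shows "(\<Sum>k=1..n. of_nat k * f k) = of_nat n * (\<Sum>k=1..n. f k) - (\<Sum>m<n. \<Sum>k=1..m. f k)"
  by (induction n) (simp_all add: algebra_simps)

text \<open>Split the sum at an index \<open>M\<close> past which \<open>e k\<close> is at most
  \<epsilon>/2 times \<open>k\<close>. The head is bounded by a constant \<open>C\<close>. Each tail
  term is at most \<epsilon>/2 times \<open>n\<close>, because \<open>k < n\<close>, and there are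
  at most \<open>n\<close> of them.\<close>

lemma sum_lessThan_over_square_tendsto_0:
  fixes e :: "nat \<Rightarrow> 'a :: real_normed_field"
  assumes "(\<lambda>n. e n / of_nat n) \<longlonglongrightarrow> 0"
  shows "(\<lambda>n. (\<Sum>k<n. e k) / of_nat n ^ 2) \<longlonglongrightarrow> 0"
proof (rule tendstoI)
  fix \<epsilon> :: real assume \<epsilon>: "\<epsilon> > 0"
  from tendstoD[OF assms, of "\<epsilon> / 2"] \<epsilon>
  obtain M where M: "\<And>n. n \<ge> M \<Longrightarrow> norm (e n / of_nat n) < \<epsilon> / 2"
    by (auto simp: eventually_at_top_linorder)
  define C where "C = (\<Sum>k\<le>M. norm (e k))"
  have bound: "norm (e k) \<le> (if k \<le> M then norm (e k) else 0) + \<epsilon> / 2 * real n" if "k < n" for k n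
  proof (cases "k \<le> M")
    case False
    hence "norm (e k) \<le> \<epsilon> / 2 * real k"
      using M[of k] by (simp add: norm_divide field_simps)
    also have "\<dots> \<le> \<epsilon> / 2 * real n"
      using that \<epsilon> by (intro mult_left_mono) auto
    finally show ?thesis using False by simp
  qed (use \<epsilon> in auto)
  have le: "norm (\<Sum>k<n. e k) \<le> C + \<epsilon> / 2 * real n ^ 2" for n
  proof -
    have "norm (\<Sum>k<n. e k) \<le> (\<Sum>k<n. (if k \<le> M then norm (e k) else 0) + \<epsilon> / 2 * real n)"
      by (intro sum_norm_le bound) auto
    also have "\<dots> = (\<Sum>k\<in>{..<n} \<inter> {..M}. norm (e k)) + \<epsilon> / 2 * real n ^ 2"
      by (simp add: sum.distrib power2_eq_square sum.inter_restrict)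
    also have "(\<Sum>k\<in>{..<n} \<inter> {..M}. norm (e k)) \<le> C"
      unfolding C_def by (intro sum_mono2) auto
    finally show ?thesis by simp
  qed
  \<comment> \<open>The other half of \<epsilon> absorbs the head, since \<open>C\<close> does not
    depend on \<open>n\<close>.\<close>
  have "\<forall>\<^sub>F n in sequentially. C < \<epsilon> / 2 * real n ^ 2"
    using \<epsilon> by real_asymp
  thus "\<forall>\<^sub>F n in sequentially. dist ((\<Sum>k<n. e k) / of_nat n ^ 2) 0 < \<epsilon>"
    using eventually_gt_at_top[of 0]
  proof eventually_elim
    case (elim n)
    have "norm (\<Sum>k<n. e k) < \<epsilon> * real n ^ 2"
      using le[of n] elim by (simp add: field_simps)
    thus ?case using elim by (simp add: norm_divide norm_power field_simps)
  qed
qed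

text \<open>Apply the previous lemma to the error \<open>s k - c * of_nat k\<close>, then add back
  the main term: c times 0 + 1 + ... + (n-1) is c n (n-1) / 2, which over n^2 equals c (1 - 1/n) /
  2.\<close>

lemma sum_lessThan_over_square_tendsto_half:
  fixes s :: "nat \<Rightarrow> 'a :: real_normed_field"
  assumes "(\<lambda>n. s n / of_nat n) \<longlonglongrightarrow> c"
  shows "(\<lambda>n. (\<Sum>k<n. s k) / of_nat n ^ 2) \<longlonglongrightarrow> c / 2"
proof -
  have "(\<lambda>n. s n / of_nat n - c) \<longlonglongrightarrow> 0"
    using tendsto_diff[OF assms tendsto_const[of c]] by simp
  hence "(\<lambda>n. (s n - c * of_nat n) / of_nat n) \<longlonglongrightarrow> 0"
    \<comment> \<open>The two sequences may differ at \<open>n = 0\<close>, where division by zero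
      gives 0.\<close>
    by (rule Lim_transform_eventually)
       (use eventually_gt_at_top[of 0] in eventually_elim, simp add: field_simps)
  hence "(\<lambda>n. (\<Sum>k<n. s k - c * of_nat k) / of_nat n ^ 2) \<longlonglongrightarrow> 0"
    by (rule sum_lessThan_over_square_tendsto_0)
  moreover have "(\<lambda>n. c * of_real ((1 - 1 / real n) / 2)) \<longlonglongrightarrow> c * of_real (1 / 2)"
    by (intro tendsto_mult tendsto_const tendsto_of_real) real_asymp
  ultimately have "(\<lambda>n. (\<Sum>k<n. s k - c * of_nat k) / of_nat n ^ 2 + c * of_real ((1 - 1 / real n) / 2))
                     \<longlonglongrightarrow> 0 + c * of_real (1 / 2)"
    by (rule tendsto_add)
  hence "(\<lambda>n. (\<Sum>k<n. s k) / of_nat n ^ 2) \<longlonglongrightarrow> 0 + c * of_real (1 / 2)"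
  proof (rule Lim_transform_eventually)
    have gauss: "(\<Sum>k<n. of_nat k) = (of_nat n * (of_nat n - 1) / 2 :: 'a)" for n
      by (induction n) (simp_all add: field_simps)
    show "\<forall>\<^sub>F n in sequentially. (\<Sum>k<n. s k - c * of_nat k) / of_nat n ^ 2 +
            c * of_real ((1 - 1 / real n) / 2) = (\<Sum>k<n. s k) / of_nat n ^ 2"
      using eventually_gt_at_top[of 0]
      by eventually_elim
         (simp add: sum_subtractf gauss field_simps power2_eq_square flip: sum_distrib_left)
  qed
  thus ?thesis by simp
qed

lemma sum_of_nat_mult_over_square_tendsto_half:
  fixes f :: "nat \<Rightarrow> 'a :: real_normed_field"
  assumes "(\<lambda>n. (\<Sum>k=1..n. f k) / of_nat n) \<longlonglongrightarrow> c"
  shows "(\<lambda>n. (\<Sum>k=1..n. of_nat k * f k) / of_nat n ^ 2) \<longlonglongrightarrow> c / 2"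
proof -
  \<comment> \<open>This holds for every \<open>n\<close>: at \<open>n = 0\<close> both sides are
    0.\<close>
  have "(\<Sum>k=1..n. of_nat k * f k) / of_nat n ^ 2 =
          (\<Sum>k=1..n. f k) / of_nat n - (\<Sum>m<n. \<Sum>k=1..m. f k) / of_nat n ^ 2" for n
    unfolding sum_of_nat_mult_eq_diff_sum_partial_sums
    by (cases "n = 0") (simp_all add: diff_divide_distrib power2_eq_square)
  moreover have "(\<lambda>n. (\<Sum>k=1..n. f k) / of_nat n - (\<Sum>m<n. \<Sum>k=1..m. f k) / of_nat n ^ 2)
                   \<longlonglongrightarrow> c - c / 2"
    by (intro tendsto_diff sum_lessThan_over_square_tendsto_half assms)
  moreover have "c - c / 2 = c / 2" by (simp add: field_simps)
  ultimately show ?thesis by simp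
qed

theorem mainTheorem1:
  fixes f :: "nat \<Rightarrow> complex" and c :: complex
  assumes "((\<lambda>x::real. 1 / of_real x * summatory f x) \<longlongrightarrow> c) at_top"
    and "c \<noteq> 0"
  shows "(\<lambda>x::real. summatory (\<lambda>n. of_nat n * f n) x)
           \<sim>[at_top] (\<lambda>x. c / 2 * of_real x ^ 2)"
proof -
  define T where "T = (\<lambda>n. \<Sum>k=1..n. of_nat k * f k)"
  define N where "N = (\<lambda>x::real. nat \<lfloor>x\<rfloor>)"
  \<comment> \<open>Restrict the hypothesis to integer \<open>x\<close>; the return to real
    \<open>x\<close> goes through \<open>N\<close>.\<close>
  have "(\<lambda>n. (\<Sum>k=1..n. f k) / of_nat n) \<longlonglongrightarrow> c"
    using filterlim_compose[OF assms(1) filterlim_real_sequentially]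
    by (simp add: summatory_altdef)
  hence "(\<lambda>n. T n / of_nat n ^ 2) \<longlonglongrightarrow> c / 2"
    unfolding T_def by (rule sum_of_nat_mult_over_square_tendsto_half)
  moreover have "filterlim N at_top at_top"
    unfolding N_def by (intro filterlim_compose[OF filterlim_nat_sequentially filterlim_floor_sequentially])
  ultimately have "((\<lambda>x. T (N x) / of_nat (N x) ^ 2) \<longlongrightarrow> c / 2) at_top"
    by (rule filterlim_compose)
  \<comment> \<open>Replacing \<open>N x\<close> by \<open>x\<close> in the denominator costs this
    factor, which tends to 1 because x - 1 < N(x) \<le> x for large \<open>x\<close>.\<close>
  moreover have "((\<lambda>x. real (N x) ^ 2 / x ^ 2) \<longlongrightarrow> 1) at_top"
    unfolding N_def by real_asymp
  hence "((\<lambda>x. complex_of_real (real (N x) ^ 2 / x ^ 2)) \<longlongrightarrow> of_real 1) at_top"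
    by (rule tendsto_of_real)
  ultimately have "((\<lambda>x. T (N x) / of_nat (N x) ^ 2 * of_real (real (N x) ^ 2 / x ^ 2) / (c / 2))
                     \<longlongrightarrow> c / 2 * of_real 1 / (c / 2)) at_top"
    by (rule tendsto_divide[OF tendsto_mult tendsto_const]) (use assms(2) in simp)
  hence "((\<lambda>x. T (N x) / (c / 2 * of_real x ^ 2)) \<longlongrightarrow> c / 2 * of_real 1 / (c / 2)) at_top"
  proof (rule Lim_transform_eventually)
    show "\<forall>\<^sub>F x in at_top. T (N x) / of_nat (N x) ^ 2 * of_real (real (N x) ^ 2 / x ^ 2) / (c / 2) =
            T (N x) / (c / 2 * of_real x ^ 2)"
      \<comment> \<open>From 1 on, \<open>N x\<close> is positive, so its square cancels.\<close>
      using eventually_ge_at_top[of 1]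
    proof eventually_elim
      case (elim x)
      hence "N x > 0" by (simp add: N_def)
      thus ?case using elim assms(2) by (simp add: field_simps)
    qed
  qed
  hence "(\<lambda>x. T (N x)) \<sim>[at_top] (\<lambda>x. c / 2 * of_real x ^ 2)"
    using assms(2) by (intro asymp_equivI') simp
  thus ?thesis
    by (simp add: summatory_altdef T_def N_def)
qed

end
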